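(* Let $m<-1$ be a square free integer with $m\equiv 2,3 \pmod 4$, let $\alpha$ be a root of $x^4-m$ (so $\alpha^4=m$), and let $K=\mathbb{Q}(\alpha)$. Then, up to equivalence, $\alpha$ is the only generator of power integral bases in $K$.
   Context: For a number field $K$ of degree $n$ with ring of integers $\mathbb{Z}_K$, an element $\gamma\in\mathbb{Z}_K$ generates a power integral basis if $\{1,\gamma,\gamma^2,\ldots,\gamma^{n-1}\}$ is an integral basis of $K$ (i.e. $\mathbb{Z}_K=\mathbb{Z}[\gamma]$). Two elements $\beta,\gamma\in\mathbb{Z}_K$ are called equivalent if $\beta+\gamma\in\mathbb{Z}$ or $\beta-\gamma\in\mathbb{Z}$; generators of power integral bases are considered only up to this equivalence. *)

theory Defs
  imports
    Complex_Main
    "HOL-Library.FuncSet"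
    "HOL-Computational_Algebra.Polynomial"
    "HOL-Computational_Algebra.Squarefree"
    "HOL-Algebra.Generated_Fields"
    "HOL-Algebra.Algebraic_Closure_Type"
begin

(* Number fields are taken as subfields of the complex numbers, given by their carrier sets. *)

definition rat_adjoin :: "complex \<Rightarrow> complex set" where
  "rat_adjoin \<alpha> = generate_field ring_of_type_algebra (insert \<alpha> \<rat>)"

lemma vector_space_of_rat: "vector_space (\<lambda>(q::rat) (x::complex). of_rat q * x)"
  by unfold_locales (simp_all add: algebra_simps of_rat_add of_rat_mult)

(* The library's dim, and hence this degree, is 0 when K is infinite-dimensional over the rationals. *)
definition field_degree :: "complex set \<Rightarrow> nat" where
  "field_degree K = vector_space.dim (\<lambda>(q::rat) (x::complex). of_rat q * x) K"

definition ring_of_integers :: "complex set \<Rightarrow> complex set" where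
  "ring_of_integers K = {x \<in> K. algebraic_int x}"

(* Unique integer coordinates of every integer of K with respect to the family b 0, ..., b (n - 1),
   n = field_degree K.  Extensionality makes the coordinate vector unique as a function on nat. *)
definition integral_basis :: "complex set \<Rightarrow> (nat \<Rightarrow> complex) \<Rightarrow> bool" where
  "integral_basis K b \<longleftrightarrow>
     (\<forall>i<field_degree K. b i \<in> ring_of_integers K) \<and>
     (\<forall>x\<in>ring_of_integers K. \<exists>!c::nat \<Rightarrow> int.
        c \<in> extensional {..<field_degree K} \<and>
        x = (\<Sum>i<field_degree K. of_int (c i) * b i))"

definition generates_power_integral_basis :: "complex set \<Rightarrow> complex \<Rightarrow> bool" where
  "generates_power_integral_basis K \<gamma> \<longleftrightarrow>
     \<gamma> \<in> ring_of_integers K \<and> integral_basis K (\<lambda>i. \<gamma> ^ i)"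

definition pib_equivalent :: "complex \<Rightarrow> complex \<Rightarrow> bool" where
  "pib_equivalent \<beta> \<gamma> \<longleftrightarrow> \<beta> + \<gamma> \<in> \<int> \<or> \<beta> - \<gamma> \<in> \<int>"

end

theory Submission
  imports Defs
begin

text \<open>
  Put \<open>\<beta> = \<alpha>\<^sup>2\<close>. Then \<open>K\<close> is reached by the two quadratic steps \<open>\<rat> \<subseteq> \<rat>(\<beta>) \<subseteq> \<rat>(\<beta>)(\<alpha>)\<close>.
  Integrality is replaced by the condition that the powers of an element have a common denominator,
  which is visibly stable under sums, products and the conjugation of a quadratic step. Traces and
  norms then show that the coordinates of an integer are halves of integers, and congruences
  modulo 4 that they are integers, so \<open>\<int>\<^sub>K = \<int>[\<alpha>]\<close>.

  If \<open>w = x\<alpha> + y\<alpha>\<^sup>2 + z\<alpha>\<^sup>3\<close> generates, write \<open>\<alpha>\<close> as an integer polynomial in \<open>w\<close>. The part odd in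
  \<open>\<alpha>\<close> of this equation says that \<open>x + z\<beta>\<close> is a unit of \<open>\<int>[\<beta>]\<close>; its norm is \<open>x\<^sup>2 - mz\<^sup>2\<close>, and
  \<open>m < -1\<close> forces \<open>z = 0\<close>, \<open>x = \<plusminus>1\<close>. The coefficient of \<open>\<alpha>\<^sup>2\<close> now shows that \<open>1 + 4my\<^sup>4\<close> divides
  \<open>y\<close>, so \<open>y = 0\<close>.
\<close>

subsection \<open>Quadratic extensions inside the complex numbers\<close>

definition csubring :: "complex set \<Rightarrow> bool" where
  "csubring S \<longleftrightarrow> 1 \<in> S \<and> (\<forall>x\<in>S. \<forall>y\<in>S. x - y \<in> S \<and> x * y \<in> S)"

definition csubfield :: "complex set \<Rightarrow> bool" where
  "csubfield S \<longleftrightarrow> csubring S \<and> (\<forall>x\<in>S. inverse x \<in> S)"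

text \<open>For \<open>t^2\<close> in \<open>R\<close> this is the ring R[t]. Applied twice, the
  operation builds the field K from \<open>\<rat>\<close> and the ring Z[\<alpha>] from
  \<open>\<int>\<close>.\<close>

definition quad :: "complex set \<Rightarrow> complex \<Rightarrow> complex set" where
  "quad R t = {a + b * t | a b. a \<in> R \<and> b \<in> R}"

lemma csubringI:
  assumes "1 \<in> S" "\<And>x y. x \<in> S \<Longrightarrow> y \<in> S \<Longrightarrow> x - y \<in> S"
    "\<And>x y. x \<in> S \<Longrightarrow> y \<in> S \<Longrightarrow> x * y \<in> S"
  shows "csubring S"
  using assms by (auto simp: csubring_def)

lemma csubring_1: "csubring S \<Longrightarrow> 1 \<in> S"
  and csubring_diff: "csubring S \<Longrightarrow> x \<in> S \<Longrightarrow> y \<in> S \<Longrightarrow> x - y \<in> S"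
  and csubring_mult: "csubring S \<Longrightarrow> x \<in> S \<Longrightarrow> y \<in> S \<Longrightarrow> x * y \<in> S"
  by (auto simp: csubring_def)

lemma csubring_0: "csubring S \<Longrightarrow> 0 \<in> S"
  using csubring_diff[of S 1 1] csubring_1 by simp

lemma csubring_uminus: "csubring S \<Longrightarrow> x \<in> S \<Longrightarrow> - x \<in> S"
  using csubring_diff[of S 0 x] csubring_0 by simp

lemma csubring_add: "csubring S \<Longrightarrow> x \<in> S \<Longrightarrow> y \<in> S \<Longrightarrow> x + y \<in> S"
  using csubring_diff[of S x "- y"] csubring_uminus by simp

lemma csubring_power: "csubring S \<Longrightarrow> x \<in> S \<Longrightarrow> x ^ n \<in> S"
  by (induction n) (auto intro: csubring_1 csubring_mult)

lemma csubring_of_nat: "csubring S \<Longrightarrow> of_nat n \<in> S"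
  by (induction n) (auto intro: csubring_0 csubring_1 csubring_add)

lemma csubring_of_int: "csubring S \<Longrightarrow> of_int n \<in> S"
  by (cases n) (auto intro: csubring_of_nat csubring_uminus simp del: of_nat_Suc)

lemma csubring_sum: "csubring S \<Longrightarrow> (\<And>i. i \<in> A \<Longrightarrow> f i \<in> S) \<Longrightarrow> sum f A \<in> S"
  by (induction A rule: infinite_finite_induct) (auto intro: csubring_0 csubring_add)

lemmas csubring_intros = csubring_1 csubring_0 csubring_diff csubring_mult csubring_uminus
  csubring_add csubring_power csubring_of_nat csubring_of_int

lemma csubring_Ints: "csubring \<int>"
  by (rule csubringI) auto

lemma csubfield_Rats: "csubfield \<rat>"
  by (auto simp: csubfield_def intro: csubringI)

lemma csubfield_csubring: "csubfield F \<Longrightarrow> csubring F"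
  by (simp add: csubfield_def)

lemma csubfield_inverse: "csubfield F \<Longrightarrow> x \<in> F \<Longrightarrow> inverse x \<in> F"
  by (simp add: csubfield_def)

lemma quadI: "a \<in> R \<Longrightarrow> b \<in> R \<Longrightarrow> a + b * t \<in> quad R t"
  by (auto simp: quad_def)

lemma quad_base: "csubring R \<Longrightarrow> a \<in> R \<Longrightarrow> a \<in> quad R t"
  using quadI[of a R 0 t] csubring_0 by simp

lemma quad_gen: "csubring R \<Longrightarrow> t \<in> quad R t"
  using quadI[of 0 R 1 t] csubring_0 csubring_1 by simp

lemma quad_mono: "R \<subseteq> S \<Longrightarrow> quad R t \<subseteq> quad S t"
  by (auto simp: quad_def)

lemma csubring_quad:
  assumes R: "csubring R" and t: "t\<^sup>2 \<in> R"
  shows "csubring (quad R t)"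
proof (rule csubringI)
  show "1 \<in> quad R t"
    using quad_base R csubring_1 by blast
next
  fix x y assume "x \<in> quad R t" "y \<in> quad R t"
  then obtain a b c d where *: "a \<in> R" "b \<in> R" "c \<in> R" "d \<in> R" "x = a + b * t" "y = c + d * t"
    by (auto simp: quad_def)
  have "x - y = (a - c) + (b - d) * t"
    using * by (simp add: algebra_simps)
  also have "\<dots> \<in> quad R t"
    by (intro quadI csubring_diff R *)
  finally show "x - y \<in> quad R t" .
  have "x * y = (a * c + b * d * t\<^sup>2) + (a * d + b * c) * t"
    using * by (simp add: algebra_simps power2_eq_square)
  also have "\<dots> \<in> quad R t"
    by (intro quadI csubring_add csubring_mult R * t)
  finally show "x * y \<in> quad R t" .
qed

text \<open>Otherwise \<open>t = - a / b\<close> would lie in \<open>F\<close>.\<close>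

lemma quad_zeroD:
  assumes F: "csubfield F" and t: "t \<notin> F" and "a \<in> F" "b \<in> F" "a + b * t = 0"
  shows "a = 0 \<and> b = 0"
proof (cases "b = 0")
  case False
  hence "t = - a * inverse b"
    using assms(5) by (simp add: field_simps add_eq_0_iff)
  moreover have "- a * inverse b \<in> F"
    by (intro csubring_mult csubring_uminus csubfield_inverse csubfield_csubring F assms)
  ultimately show ?thesis using t by simp
qed (use assms in auto)

lemma quad_unique:
  assumes F: "csubfield F" and t: "t \<notin> F" and "a \<in> F" "b \<in> F" "c \<in> F" "d \<in> F"
    and "a + b * t = c + d * t"
  shows "a = c \<and> b = d"
  using quad_zeroD[OF F t, of "a - c" "b - d"] assms csubring_diff[OF csubfield_csubring[OF F]]
  by (simp add: algebra_simps)

text \<open>The inverse of \<open>a + b * t\<close> is its conjugate \<open>a - b * t\<close>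
  divided by the norm, which is nonzero because the conjugate of a nonzero element is
  nonzero.\<close>

lemma csubfield_quad:
  assumes F: "csubfield F" and t: "t \<notin> F" "t\<^sup>2 \<in> F"
  shows "csubfield (quad F t)"
  unfolding csubfield_def
proof (intro conjI ballI)
  note R = csubfield_csubring[OF F]
  show "csubring (quad F t)"
    by (intro csubring_quad R t)
  fix x assume "x \<in> quad F t"
  then obtain a b where ab: "a \<in> F" "b \<in> F" "x = a + b * t"
    by (auto simp: quad_def)
  show "inverse x \<in> quad F t"
  proof (cases "x = 0")
    case True
    thus ?thesis using R by (auto intro: quad_base csubring_0)
  next
    case False
    define n where "n = a\<^sup>2 - b\<^sup>2 * t\<^sup>2"
    have n: "n \<in> F"
      unfolding n_def by (intro csubring_intros R ab t)
    have conj: "a + (- b) * t \<noteq> 0"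
    proof
      assume "a + (- b) * t = 0"
      hence "a = 0 \<and> - b = 0"
        by (intro quad_zeroD[OF F t(1)] ab csubring_uminus R)
      thus False using False ab by simp
    qed
    have eq: "x * (a + (- b) * t) = n"
      by (simp add: ab n_def power2_eq_square algebra_simps)
    hence "n \<noteq> 0" using False conj by auto
    hence "inverse x = a * inverse n + (- b * inverse n) * t"
      using eq False by (simp add: field_simps)
    also have "\<dots> \<in> quad F t"
      by (intro quadI csubring_intros R ab csubfield_inverse[OF F] n)
    finally show ?thesis .
  qed
qed

subsection \<open>Almost integral elements\<close>

text \<open>Denominators are nonzero integers rather than elements of \<open>R\<close>, so
  conjugation fixes them and one \<open>D\<close> serves a ring and its quadratic extension
  alike.\<close>

definition almost_integral :: "complex set \<Rightarrow> complex \<Rightarrow> bool" where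
  "almost_integral R x \<longleftrightarrow> (\<exists>D::int. D \<noteq> 0 \<and> (\<forall>k. of_int D * x ^ k \<in> R))"

lemma almost_integral_mem: "csubring R \<Longrightarrow> x \<in> R \<Longrightarrow> almost_integral R x"
  unfolding almost_integral_def by (rule exI[of _ 1]) (auto intro: csubring_power)

lemma almost_integral_mult:
  assumes R: "csubring R" and "almost_integral R x" "almost_integral R y"
  shows "almost_integral R (x * y)"
proof -
  obtain D E :: int where D: "D \<noteq> 0" "\<And>k. of_int D * x ^ k \<in> R"
    and E: "E \<noteq> 0" "\<And>k. of_int E * y ^ k \<in> R"
    using assms by (auto simp: almost_integral_def)
  have "of_int (D * E) * (x * y) ^ k \<in> R" for k
    using csubring_mult[OF R D(2)[of k] E(2)[of k]] by (simp add: power_mult_distrib mult_ac)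
  thus ?thesis using D E unfolding almost_integral_def by (intro exI[of _ "D * E"]) auto
qed

text \<open>If \<open>D\<close> serves for \<open>x\<close> and \<open>E\<close> for
  \<open>y\<close>, then \<open>D * E\<close> clears every term of the binomial expansion of
  \<open>(x + y) ^ k\<close>.\<close>

lemma almost_integral_add:
  assumes R: "csubring R" and "almost_integral R x" "almost_integral R y"
  shows "almost_integral R (x + y)"
proof -
  obtain D E :: int where D: "D \<noteq> 0" "\<And>k. of_int D * x ^ k \<in> R"
    and E: "E \<noteq> 0" "\<And>k. of_int E * y ^ k \<in> R"
    using assms by (auto simp: almost_integral_def)
  have "of_int (D * E) * (x + y) ^ k \<in> R" for k
  proof -
    have "of_int (D * E) * (x + y) ^ k =
        (\<Sum>i\<le>k. of_nat (k choose i) * ((of_int D * x ^ i) * (of_int E * y ^ (k - i))))"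
      by (simp add: binomial_ring sum_distrib_left mult_ac)
    also have "\<dots> \<in> R"
      by (intro csubring_sum csubring_mult csubring_of_nat R D E)
    finally show ?thesis .
  qed
  thus ?thesis using D E unfolding almost_integral_def by (intro exI[of _ "D * E"]) auto
qed

text \<open>Conjugate powers have conjugate coordinates, so a denominator for
  \<open>a + b * t\<close> also works for \<open>a - b * t\<close>.\<close>

lemma almost_integral_conj:
  assumes F: "csubfield F" and t: "t \<notin> F" "t\<^sup>2 \<in> R" and R: "csubring R" "R \<subseteq> F"
    and ab: "a \<in> F" "b \<in> F" and ai: "almost_integral (quad R t) (a + b * t)"
  shows "almost_integral (quad R t) (a - b * t)"
proof -
  note FR = csubfield_csubring[OF F]
  obtain D :: int where D: "D \<noteq> 0" "\<And>k. of_int D * (a + b * t) ^ k \<in> quad R t"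
    using ai by (auto simp: almost_integral_def)
  have "of_int D * (a - b * t) ^ k \<in> quad R t" for k
  proof -
    \<comment> \<open>Conjugation is not set up as a map; both powers are carried through one
      induction. The coordinates are only known to lie in \<open>F\<close> until \<open>D\<close> is
      multiplied in.\<close>
    have "\<exists>A\<in>F. \<exists>B\<in>F. (a + b * t) ^ k = A + B * t \<and> (a - b * t) ^ k = A - B * t"
    proof (induction k)
      case 0
      show ?case by (rule bexI[of _ 1], rule bexI[of _ 0]) (auto intro: csubring_0 csubring_1 FR)
    next
      case (Suc k)
      then obtain A B where AB: "A \<in> F" "B \<in> F" "(a + b * t) ^ k = A + B * t"
        "(a - b * t) ^ k = A - B * t" by auto
      have "t\<^sup>2 \<in> F" using t R by auto
      show ?case
      proof (rule bexI[of _ "a * A + b * B * t\<^sup>2"], rule bexI[of _ "a * B + b * A"])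
        show "a * A + b * B * t\<^sup>2 \<in> F" "a * B + b * A \<in> F"
          by (intro csubring_intros FR ab AB \<open>t\<^sup>2 \<in> F\<close>)+
        show "(a + b * t) ^ Suc k = a * A + b * B * t\<^sup>2 + (a * B + b * A) * t \<and>
          (a - b * t) ^ Suc k = a * A + b * B * t\<^sup>2 - (a * B + b * A) * t"
          by (simp add: AB algebra_simps power2_eq_square)
      qed
    qed
    then obtain A B where AB: "A \<in> F" "B \<in> F" "(a + b * t) ^ k = A + B * t"
      "(a - b * t) ^ k = A - B * t" by auto
    obtain r s where rs: "r \<in> R" "s \<in> R" "of_int D * (a + b * t) ^ k = r + s * t"
      using D(2)[of k] by (auto simp: quad_def)
    have "of_int D * A + (of_int D * B) * t = r + s * t"
      using rs AB by (simp add: algebra_simps)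
    hence "of_int D * A = r \<and> of_int D * B = s"
      using rs AB R by (intro quad_unique[OF F t(1)] csubring_mult csubring_of_int FR) auto
    moreover have "of_int D * (a - b * t) ^ k = of_int D * A - (of_int D * B) * t"
      by (simp add: AB algebra_simps)
    ultimately have "of_int D * (a - b * t) ^ k = r + (- s) * t"
      by simp
    also have "\<dots> \<in> quad R t"
      by (intro quadI csubring_uminus R rs)
    finally show ?thesis .
  qed
  thus ?thesis using D unfolding almost_integral_def by auto
qed

text \<open>By uniqueness of coordinates, an element of \<open>F\<close> that lies in
  \<open>quad R t\<close> has \<open>t\<close>-coordinate 0 and so lies in \<open>R\<close>.\<close>

lemma almost_integral_descend:
  assumes F: "csubfield F" and t: "t \<notin> F" and R: "R \<subseteq> F"
    and x: "x \<in> F" and ai: "almost_integral (quad R t) x"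
  shows "almost_integral R x"
proof -
  note FR = csubfield_csubring[OF F]
  obtain D :: int where D: "D \<noteq> 0" "\<And>k. of_int D * x ^ k \<in> quad R t"
    using ai by (auto simp: almost_integral_def)
  have "of_int D * x ^ k \<in> R" for k
  proof -
    obtain r s where rs: "r \<in> R" "s \<in> R" "of_int D * x ^ k = r + s * t"
      using D(2)[of k] by (auto simp: quad_def)
    have "of_int D * x ^ k \<in> F"
      by (intro csubring_intros FR x)
    moreover have "of_int D * x ^ k + 0 * t = r + s * t"
      using rs by simp
    ultimately have "of_int D * x ^ k = r \<and> 0 = s"
      using rs(1,2) R by (intro quad_unique[OF F t] csubring_0[OF FR]) auto
    thus ?thesis using rs by simp
  qed
  thus ?thesis using D unfolding almost_integral_def by auto
qed

text \<open>The sum and the product of \<open>a + b * t\<close> and its conjugate are almost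
  integral over \<open>quad R t\<close> and lie in \<open>F\<close>, so they descend to
  \<open>R\<close>.\<close>

lemma almost_integral_trace_norm:
  assumes F: "csubfield F" and t: "t \<notin> F" "t\<^sup>2 \<in> R" and R: "csubring R" "R \<subseteq> F"
    and ab: "a \<in> F" "b \<in> F" and ai: "almost_integral (quad R t) (a + b * t)"
  shows "almost_integral R (2 * a)" "almost_integral R (a\<^sup>2 - b\<^sup>2 * t\<^sup>2)"
proof -
  note FR = csubfield_csubring[OF F]
  note Q = csubring_quad[OF R(1) t(2)]
  note c = almost_integral_conj[OF assms]
  have "a + a \<in> F"
    by (intro csubring_add FR ab)
  thus "almost_integral R (2 * a)"
    using almost_integral_descend[OF F t(1) R(2) _ almost_integral_add[OF Q ai c]] by simp
  have "t\<^sup>2 \<in> F" using t R by auto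
  have "(a + b * t) * (a - b * t) = a\<^sup>2 - b\<^sup>2 * t\<^sup>2"
    by (simp add: algebra_simps power2_eq_square)
  moreover have "a\<^sup>2 - b\<^sup>2 * t\<^sup>2 \<in> F"
    by (intro csubring_intros FR ab \<open>t\<^sup>2 \<in> F\<close>)
  ultimately show "almost_integral R (a\<^sup>2 - b\<^sup>2 * t\<^sup>2)"
    using almost_integral_descend[OF F t(1) R(2) _ almost_integral_mult[OF Q ai c]] by simp
qed

section \<open>Denominators of rational numbers and of algebraic integers\<close>

lemma Rats_coprimeE:
  assumes "x \<in> (\<rat> :: complex set)"
  obtains a b :: int where "b > 0" "coprime a b" "x * of_int b = of_int a"
proof -
  from assms obtain a b :: int where "b > 0" "coprime a b" "x = of_int a / of_int b"
    by (rule Rats_cases') blast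
  thus ?thesis by (intro that[of b a]) auto
qed

text \<open>For \<open>x = a / b\<close> in lowest terms, \<open>b ^ k\<close> divides
  \<open>D\<close> for every \<open>k\<close>, which is impossible when
  \<open>b > 1\<close>.\<close>

lemma almost_integral_Ints:
  assumes x: "x \<in> \<rat>" and ai: "almost_integral \<int> x"
  shows "x \<in> \<int>"
proof -
  obtain D :: int where D: "D \<noteq> 0" "\<And>k. of_int D * x ^ k \<in> \<int>"
    using ai by (auto simp: almost_integral_def)
  obtain a b :: int where ab: "b > 0" "coprime a b" "x * of_int b = of_int a"
    using x by (rule Rats_coprimeE)
  \<comment> \<open>This exponent makes \<open>2 ^ k\<close> exceed
    \<open>\<bar>D\<bar>\<close>.\<close>
  define k where "k = nat \<bar>D\<bar>"
  obtain e where e: "of_int D * x ^ k = of_int e"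
    using D(2)[of k] by (auto elim: Ints_cases)
  have "of_int (D * a ^ k) = of_int D * (x * of_int b) ^ k"
    by (simp add: ab)
  also have "\<dots> = of_int (e * b ^ k)"
    by (simp add: power_mult_distrib flip: e mult.assoc)
  finally have "D * a ^ k = e * b ^ k"
    by (simp only: of_int_eq_iff)
  hence "b ^ k dvd D * a ^ k" by simp
  moreover have "coprime (b ^ k) (a ^ k)"
    using ab by (simp add: coprime_commute)
  ultimately have "b ^ k dvd D"
    by (simp add: coprime_dvd_mult_left_iff)
  hence le: "b ^ k \<le> \<bar>D\<bar>"
    using D(1) dvd_imp_le_int[of D "b ^ k"] ab(1) by simp
  have "b = 1"
  proof (rule ccontr)
    assume "b \<noteq> 1"
    hence "b \<ge> 2" using ab by simp
    hence "(2::int) ^ k \<le> b ^ k"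
      by (intro power_mono) auto
    moreover have "int k < 2 ^ k"
      by (metis of_nat_less_two_power)
    ultimately show False
      using le by (simp add: k_def)
  qed
  thus ?thesis using ab by simp
qed

text \<open>Let \<open>n\<close> be the degree of a monic integer polynomial with root
  \<open>x\<close>. The denominator \<open>d ^ n\<close> covers exponents below \<open>n\<close>
  directly, and the equation reduces higher exponents to smaller ones.\<close>

lemma algebraic_int_almost_integral:
  assumes R: "csubring R" and x: "algebraic_int x" and d: "d \<noteq> 0" "of_int d * x \<in> R"
  shows "almost_integral R x"
proof -
  obtain p where p: "\<And>i. coeff p i \<in> \<int>" "lead_coeff p = 1" "poly p x = 0"
    using x by (auto simp: algebraic_int.simps)
  define n where "n = degree p"
  have "of_int (d ^ n) * x ^ k \<in> R" for k
  proof (induction k rule: less_induct)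
    case (less k)
    show ?case
    proof (cases "k < n")
      case True
      have "of_int (d ^ n) * x ^ k = of_int (d ^ (n - k)) * (of_int d * x) ^ k"
        using True by (simp add: power_mult_distrib flip: power_add mult.assoc)
      also have "\<dots> \<in> R"
        by (intro csubring_intros R d)
      finally show ?thesis .
    next
      case False
      have "0 = (\<Sum>i\<le>n. coeff p i * x ^ i)"
        using p by (simp add: poly_altdef n_def)
      also have "\<dots> = (\<Sum>i<n. coeff p i * x ^ i) + x ^ n"
        using p by (simp add: n_def flip: lessThan_Suc_atMost)
      finally have "x ^ n = - (\<Sum>i<n. coeff p i * x ^ i)"
        by (simp add: eq_neg_iff_add_eq_0 add.commute)
      hence "of_int (d ^ n) * x ^ k = - (of_int (d ^ n) * (\<Sum>i<n. coeff p i * x ^ i) * x ^ (k - n))"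
        using False power_add[of x n "k - n"] by simp
      also have "\<dots> = - (\<Sum>i<n. coeff p i * (of_int (d ^ n) * x ^ (i + (k - n))))"
        by (simp add: sum_distrib_left sum_distrib_right power_add mult_ac)
      also have "\<dots> \<in> R"
      proof (intro csubring_uminus csubring_sum R)
        fix i assume "i \<in> {..<n}"
        hence "i + (k - n) < k" using False by simp
        moreover have "coeff p i \<in> R"
          using p(1)[of i] csubring_of_int[OF R] by (auto elim: Ints_cases)
        ultimately show "coeff p i * (of_int (d ^ n) * x ^ (i + (k - n))) \<in> R"
          by (intro csubring_mult[OF R] less)
      qed
      finally show ?thesis .
    qed
  qed
  thus ?thesis
    using d unfolding almost_integral_def by (intro exI[of _ "d ^ n"]) auto
qed

text \<open>For \<open>r = a / b\<close> in lowest terms, \<open>b^2\<close> divides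
  \<open>m\<close>, so \<open>b = 1\<close>. With \<open>m = 1\<close> it says that a rational
  square root of an integer is an integer.\<close>

lemma squarefree_mult_square_Ints:
  assumes m: "squarefree m" and r: "r \<in> \<rat>"
    and e: "of_int m * r\<^sup>2 = (of_int e :: complex)"
  shows "r \<in> \<int>"
proof -
  obtain a b :: int where ab: "b > 0" "coprime a b" "r * of_int b = of_int a"
    using r by (rule Rats_coprimeE)
  have "of_int (m * a\<^sup>2) = of_int m * (r * of_int b)\<^sup>2"
    by (simp add: ab)
  also have "\<dots> = of_int (e * b\<^sup>2)"
    by (simp add: power_mult_distrib flip: e mult.assoc)
  finally have "m * a\<^sup>2 = e * b\<^sup>2"
    by (simp only: of_int_eq_iff)
  hence "b\<^sup>2 dvd m * a\<^sup>2" by simp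
  moreover have "coprime (b\<^sup>2) (a\<^sup>2)"
    using ab by (simp add: coprime_commute)
  ultimately have "b\<^sup>2 dvd m"
    by (simp add: coprime_dvd_mult_left_iff)
  hence "b dvd 1"
    using m squarefreeD by blast
  hence "b = 1"
    using ab by simp
  thus ?thesis using ab by simp
qed


text \<open>Climbs the tower to find the denominator that
  \<open>algebraic_int_almost_integral\<close> asks for.\<close>

lemma quad_common_denominator:
  assumes R: "csubring R" and F: "\<And>y. y \<in> F \<Longrightarrow> \<exists>d::int. d \<noteq> 0 \<and> of_int d * y \<in> R"
    and x: "x \<in> quad F t"
  shows "\<exists>d::int. d \<noteq> 0 \<and> of_int d * x \<in> quad R t"
proof -
  obtain a b where ab: "a \<in> F" "b \<in> F" "x = a + b * t"
    using x by (auto simp: quad_def)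
  obtain d e :: int where de: "d \<noteq> 0" "of_int d * a \<in> R" "e \<noteq> 0" "of_int e * b \<in> R"
    using F ab by metis
  have "of_int (d * e) * x = of_int e * (of_int d * a) + (of_int d * (of_int e * b)) * t"
    by (simp add: ab algebra_simps)
  also have "\<dots> \<in> quad R t"
    by (intro quadI csubring_mult csubring_of_int R de)
  finally show ?thesis
    using de by (intro exI[of _ "d * e"]) auto
qed

subsection \<open>Congruences and equations over the integers\<close>

lemma square_mod_4: "(a::int)\<^sup>2 mod 4 = (if even a then 0 else 1)"
proof (cases "even a")
  case True
  then obtain k where "a = 2 * k" by blast
  thus ?thesis by (simp add: power2_eq_square)
next
  case False
  then obtain k where "a = 2 * k + 1" by (rule oddE)
  hence "a\<^sup>2 = 4 * (k\<^sup>2 + k) + 1" by (simp add: power2_eq_square algebra_simps)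
  hence "a\<^sup>2 mod 4 = 1" by presburger
  thus ?thesis using False by simp
qed

lemma double_prod_mod_4: "2 * ((a::int) * b) mod 4 = (if even a \<or> even b then 0 else 2)"
proof -
  have "2 * (a * b) mod 4 = 2 * (a * b mod 2)"
    using mod_mult_mult1[of 2 "a * b" 2] by simp
  also have "a * b mod 2 = (if even (a * b) then 0 else 1)"
    by presburger
  finally show ?thesis by simp
qed

text \<open>For \<open>c\<close>, \<open>e\<close> twice the coordinates of an element of
  Q(\<beta>), the divisibility says that its norm is an integer. Squares are 0 or 1 modulo 4, while
  \<open>m * e^2\<close> is 2 or 3 for odd \<open>e\<close>.\<close>

lemma mod_4_quadratic_norm:
  fixes m c e :: int
  assumes m: "m mod 4 = 2 \<or> m mod 4 = 3" and dvd: "4 dvd c\<^sup>2 - m * e\<^sup>2"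
  shows "even c \<and> even e"
proof -
  have "(m * e\<^sup>2) mod 4 = ((m mod 4) * (e\<^sup>2 mod 4)) mod 4"
    by (simp add: mod_mult_eq)
  moreover have "c\<^sup>2 mod 4 = (m * e\<^sup>2) mod 4"
    using dvd by (simp add: mod_eq_dvd_iff)
  ultimately show ?thesis
    using m by (auto simp: square_mod_4 split: if_splits)
qed

text \<open>For doubled coordinates of an element of K, the two expressions are four times the
  coordinates of its relative norm to Q(\<beta>). Modulo 4 they depend only on parities and on the
  residue of \<open>m\<close>, which leaves a finite check.\<close>

lemma mod_4_quartic_norm:
  fixes m a b c d :: int
  assumes m: "m mod 4 = 2 \<or> m mod 4 = 3"
    and dvd1: "4 dvd a\<^sup>2 + m * c\<^sup>2 - m * (2 * (b * d))"
    and dvd2: "4 dvd 2 * (a * c) - b\<^sup>2 - m * d\<^sup>2"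
  shows "even a \<and> even b \<and> even c \<and> even d"
proof -
  have eqs: "(m * c\<^sup>2) mod 4 = ((m mod 4) * (c\<^sup>2 mod 4)) mod 4"
    "(m * d\<^sup>2) mod 4 = ((m mod 4) * (d\<^sup>2 mod 4)) mod 4"
    "(m * (2 * (b * d))) mod 4 = ((m mod 4) * (2 * (b * d) mod 4)) mod 4"
    by (simp_all add: mod_mult_eq)
  have 1: "(((a\<^sup>2 mod 4) + (m * c\<^sup>2) mod 4) mod 4 - (m * (2 * (b * d))) mod 4) mod 4 = 0"
    using dvd1 by (simp only: mod_add_left_eq mod_add_right_eq mod_diff_left_eq mod_diff_right_eq dvd_eq_mod_eq_0)
  have 2: "(((2 * (a * c)) mod 4 - b\<^sup>2 mod 4) mod 4 - (m * d\<^sup>2) mod 4) mod 4 = 0"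
    using dvd2 by (simp only: mod_diff_left_eq mod_diff_right_eq dvd_eq_mod_eq_0)
  show ?thesis
    using m 1 2 unfolding eqs square_mod_4 double_prod_mod_4
    by (elim disjE; cases "even a"; cases "even b"; cases "even c"; cases "even d"; simp)
qed

lemma Ints_halfI: "2 * x = of_int a \<Longrightarrow> even a \<Longrightarrow> x \<in> (\<int> :: complex set)"
  by (auto elim!: evenE)

text \<open>
  The hypotheses are the coefficients of \<open>\<alpha>\<close>, \<open>\<alpha>\<^sup>2\<close> and \<open>\<alpha>\<^sup>3\<close> in \<open>pw + qw\<^sup>2 + rw\<^sup>3 = \<alpha>\<close> up to a
  constant, where \<open>w = x\<alpha> + y\<alpha>\<^sup>2 + z\<alpha>\<^sup>3\<close> and \<open>\<alpha>\<^sup>4 = m\<close>.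
\<close>

lemma unit_equations_solution:
  fixes m x y z p q r :: int
  assumes m: "m < -1"
    and e1: "p * x + q * (2 * y * z * m) +
      r * (x * (3 * y\<^sup>2 * m + 2 * x * z * m) + z * m * (x\<^sup>2 + z\<^sup>2 * m)) = 1"
    and e2: "p * y + q * (x\<^sup>2 + z\<^sup>2 * m) + r * (y * (y\<^sup>2 * m + 6 * x * z * m)) = 0"
    and e3: "p * z + q * (2 * x * y) +
      r * (x * (x\<^sup>2 + z\<^sup>2 * m) + z * (3 * y\<^sup>2 * m + 2 * x * z * m)) = 0"
  shows "(x = 1 \<or> x = -1) \<and> y = 0 \<and> z = 0"
proof -
  \<comment> \<open>\<open>s + t\<beta>\<close> is the inverse of \<open>x + z\<beta>\<close>, where \<open>\<beta>\<^sup>2 = m\<close>.\<close>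
  define s where "s = p + r * (3 * y\<^sup>2 * m + 2 * x * z * m)"
  define t where "t = 2 * q * y + r * (x\<^sup>2 + z\<^sup>2 * m)"
  have st: "x * s + m * z * t = 1" "z * s + x * t = 0"
    using e1 e3 by (simp_all add: s_def t_def algebra_simps)
  \<comment> \<open>Multiplicativity of the norm, applied to (x + z\<beta>)(s + t\<beta>) =
    1.\<close>
  have "(x\<^sup>2 - m * z\<^sup>2) * (s\<^sup>2 - m * t\<^sup>2) = (x * s + m * z * t)\<^sup>2 - m * (z * s + x * t)\<^sup>2"
    by (simp add: algebra_simps power2_eq_square)
  hence "(x\<^sup>2 - m * z\<^sup>2) * (s\<^sup>2 - m * t\<^sup>2) = 1"
    by (simp add: st)
  hence "x\<^sup>2 - m * z\<^sup>2 dvd 1"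
    by (metis dvd_triv_left)
  \<comment> \<open>As \<open>m \<le> -2\<close>, the norm is at least \<open>x^2 + 2 * z^2\<close>;
    as a divisor of 1 it is at most 1.\<close>
  moreover have "- m * z\<^sup>2 \<ge> 2 * z\<^sup>2"
    using m by (intro mult_right_mono) auto
  ultimately have le: "x\<^sup>2 + 2 * z\<^sup>2 \<le> 1"
    by (auto dest!: zdvd_imp_le)
  have z: "z = 0"
  proof (rule ccontr)
    assume "z \<noteq> 0"
    hence "z\<^sup>2 > 0" by simp
    thus False using le zero_le_power2[of x] by linarith
  qed
  have x: "x * x = 1" "x = 1 \<or> x = -1"
  proof -
    show "x = 1 \<or> x = -1"
      using st z by (auto simp: zmult_eq_1_iff)
    thus "x * x = 1" by auto
  qed
  have y: "y = 0"
  proof (rule ccontr)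
    assume y: "y \<noteq> 0"
    \<comment> \<open>With \<open>z = 0\<close> and \<open>x * x = 1\<close>, the equations for
      \<alpha>^3 and \<alpha> determine \<open>r\<close> and \<open>p\<close>; the one for
      \<alpha>^2 then becomes a divisibility.\<close>
    have r: "r = - 2 * q * y"
      using e3 x(2) by (auto simp: z)
    have p: "p = x - 3 * y\<^sup>2 * m * r"
      using e1 x(2) by (auto simp: z algebra_simps)
    have "q * (1 + 4 * y ^ 4 * m) = - x * y"
      using e2 x by (auto simp: z p r algebra_simps power2_eq_square power4_eq_xxxx)
    hence "1 + 4 * y ^ 4 * m dvd - x * y"
      by (metis dvd_triv_right)
    hence "1 + 4 * y ^ 4 * m dvd y"
      using x(2) by auto
    \<comment> \<open>For nonzero \<open>y\<close> the left side is at least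
      \<open>8 * y ^ 4 - 1\<close>, which exceeds \<open>\<bar>y\<bar>\<close>.\<close>
    hence "\<bar>1 + 4 * y ^ 4 * m\<bar> \<le> \<bar>y\<bar>"
      using y by (rule dvd_imp_le_int[rotated])
    moreover have "\<bar>y\<bar> ^ 1 \<le> \<bar>y\<bar> ^ 4"
      using y by (intro power_increasing) auto
    hence "\<bar>y\<bar> \<le> y ^ 4" by simp
    moreover have "y ^ 4 * m \<le> y ^ 4 * (-2)"
      using m by (intro mult_left_mono) auto
    ultimately show False using y by linarith
  qed
  show ?thesis using x y z by simp
qed

subsection \<open>The pure quartic field\<close>

locale pure_quartic =
  fixes m :: int and \<alpha> :: complex
  assumes m_less: "m < -1" and m_squarefree: "squarefree m"
    and m_mod_4: "m mod 4 = 2 \<or> m mod 4 = 3" and root: "\<alpha> ^ 4 = of_int m"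
begin

section \<open>The two quadratic steps\<close>

abbreviation \<beta> :: complex where "\<beta> \<equiv> \<alpha>\<^sup>2"

lemma \<beta>_squared: "\<beta>\<^sup>2 = of_int m"
  using root by (simp flip: power_mult)

text \<open>The square of \<beta> is negative.\<close>

lemma \<beta>_notin_Rats: "\<beta> \<notin> \<rat>"
proof
  assume "\<beta> \<in> \<rat>"
  then obtain a b :: int where ab: "b > 0" "\<beta> * of_int b = of_int a"
    by (rule Rats_coprimeE)
  have "of_int (a\<^sup>2) = (\<beta> * of_int b)\<^sup>2" by (simp add: ab)
  also have "\<dots> = of_int (m * b\<^sup>2)"
    by (simp only: power_mult_distrib \<beta>_squared) simp
  finally have "a\<^sup>2 = m * b\<^sup>2" by (simp only: of_int_eq_iff)
  moreover have "m * b\<^sup>2 < 0"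
    using m_less ab by (intro mult_neg_pos) auto
  ultimately show False by (metis not_less zero_le_power2)
qed

text \<open>Squaring \<open>\<alpha> = c + d * \<beta>\<close> makes -m the square of the rational
  \<open>c / d\<close>, hence of an integer. Squarefreeness leaves only m = -1, which is
  excluded.\<close>

lemma \<alpha>_notin: "\<alpha> \<notin> quad \<rat> \<beta>"
proof
  assume "\<alpha> \<in> quad \<rat> \<beta>"
  then obtain c d where cd: "c \<in> \<rat>" "d \<in> \<rat>" "\<alpha> = c + d * \<beta>"
    by (auto simp: quad_def)
  have "(c\<^sup>2 + d\<^sup>2 * of_int m) + (2 * c * d) * \<beta> = (c + d * \<beta>)\<^sup>2"
    by (simp add: power2_sum power_mult_distrib root)
  also have "\<dots> = 0 + 1 * \<beta>" by (simp flip: cd(3))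
  finally have *: "c\<^sup>2 + d\<^sup>2 * of_int m = 0 \<and> 2 * c * d = 1"
    using cd by (intro quad_unique[OF csubfield_Rats \<beta>_notin_Rats]) auto
  hence d: "d \<noteq> 0" by auto
  have "c\<^sup>2 = - of_int m * d\<^sup>2"
    using * by (simp add: eq_neg_iff_add_eq_0 mult.commute)
  hence r: "(c / d)\<^sup>2 = of_int (- m)"
    using d by (simp add: power_divide)
  have "c / d \<in> \<int>"
    by (rule squarefree_mult_square_Ints[of 1 _ "- m"]) (use cd r in auto)
  then obtain k where "c / d = of_int k" by (auto elim: Ints_cases)
  hence "of_int (k\<^sup>2) = (of_int (- m) :: complex)"
    using r by simp
  hence k: "k\<^sup>2 = - m" by (simp only: of_int_eq_iff)
  hence "k\<^sup>2 dvd m" by simp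
  hence "k dvd 1" using m_squarefree squarefreeD by blast
  hence "k\<^sup>2 = 1" by (auto simp: zdvd1_eq power2_eq_1_iff)
  thus False using k m_less by simp
qed

lemma csubfield_\<beta>: "csubfield (quad \<rat> \<beta>)"
  by (intro csubfield_quad csubfield_Rats \<beta>_notin_Rats) (simp add: root)

lemma csubring_\<beta>: "csubring (quad \<int> \<beta>)"
  by (intro csubring_quad csubring_Ints) (simp add: root)

lemma \<beta>_in: "\<beta> \<in> quad \<rat> \<beta>" "\<beta> \<in> quad \<int> \<beta>"
  by (auto intro: quad_gen csubring_Ints csubfield_csubring csubfield_Rats)

lemma csubfield_\<alpha>: "csubfield (quad (quad \<rat> \<beta>) \<alpha>)"
  by (intro csubfield_quad csubfield_\<beta> \<alpha>_notin \<beta>_in)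

lemma csubring_\<alpha>: "csubring (quad (quad \<int> \<beta>) \<alpha>)"
  by (intro csubring_quad csubring_\<beta> \<beta>_in)

section \<open>Integers of Q(\<beta>) and of K\<close>

text \<open>The trace makes \<open>2 * c\<close> an integer, four times the norm then makes
  \<open>m * (2 * d)^2\<close> one, and squarefreeness gives \<open>2 * d\<close>. The congruence
  modulo 4 removes the factors 2.\<close>

lemma almost_integral_\<beta>:
  assumes cd: "c \<in> \<rat>" "d \<in> \<rat>" and ai: "almost_integral (quad \<int> \<beta>) (c + d * \<beta>)"
  shows "c \<in> \<int> \<and> d \<in> \<int>"
proof -
  have sub: "\<int> \<subseteq> (\<rat> :: complex set)" by (auto elim: Ints_cases)
  have \<beta>2: "\<beta>\<^sup>2 \<in> \<int>" by (simp add: root)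
  note tn = almost_integral_trace_norm[OF csubfield_Rats \<beta>_notin_Rats \<beta>2 csubring_Ints sub cd ai]
  have c: "2 * c \<in> \<int>"
    using cd by (intro almost_integral_Ints tn) auto
  have n: "c\<^sup>2 - d\<^sup>2 * of_int m \<in> \<int>"
    using almost_integral_Ints[OF _ tn(2)] cd by (simp add: root)
  obtain C N where CN: "2 * c = of_int C" "c\<^sup>2 - d\<^sup>2 * of_int m = of_int N"
    using c n by (metis Ints_cases)
  have eq: "of_int m * (2 * d)\<^sup>2 = (2 * c)\<^sup>2 - 4 * (c\<^sup>2 - d\<^sup>2 * of_int m)"
    by (simp add: power_mult_distrib)
  also have "\<dots> = of_int (C\<^sup>2 - 4 * N)" by (simp add: CN)
  finally have e: "of_int m * (2 * d)\<^sup>2 = of_int (C\<^sup>2 - 4 * N)" .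
  have "2 * d \<in> \<int>"
    by (rule squarefree_mult_square_Ints[OF m_squarefree _ e]) (use cd in auto)
  then obtain E where E: "2 * d = of_int E" by (auto elim: Ints_cases)
  have "(of_int (m * E\<^sup>2) :: complex) = of_int (C\<^sup>2 - 4 * N)"
    using e by (simp add: E)
  hence "m * E\<^sup>2 = C\<^sup>2 - 4 * N" by (simp only: of_int_eq_iff)
  hence "even C \<and> even E"
    by (intro mod_4_quadratic_norm[OF m_mod_4]) simp
  thus ?thesis using CN E Ints_halfI by blast
qed

text \<open>Relative traces and the relative norm to Q(\<beta>) are almost integral, so
  \<open>almost_integral_\<beta>\<close> makes their coordinates integers. These bound the
  denominators by 2, and parities finish.\<close>

lemma almost_integral_\<alpha>:
  assumes q: "a \<in> \<rat>" "b \<in> \<rat>" "c \<in> \<rat>" "d \<in> \<rat>"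
    and ai: "almost_integral (quad (quad \<int> \<beta>) \<alpha>) ((a + c * \<beta>) + (b + d * \<beta>) * \<alpha>)"
  shows "a \<in> \<int> \<and> b \<in> \<int> \<and> c \<in> \<int> \<and> d \<in> \<int>"
proof -
  have sub: "quad \<int> \<beta> \<subseteq> quad \<rat> \<beta>" by (intro quad_mono) (auto elim: Ints_cases)
  note tn = almost_integral_trace_norm[OF csubfield_\<beta> \<alpha>_notin \<beta>_in(2) csubring_\<beta> sub]
  note tn1 = tn[OF _ _ ai]
  \<comment> \<open>The trace of the element itself sees only the even coordinates \<open>a\<close>,
    \<open>c\<close>. Multiplication by \<alpha> moves \<open>m * d\<close> and \<open>b\<close>
    into their places.\<close>
  have "almost_integral (quad (quad \<int> \<beta>) \<alpha>) (\<alpha> * ((a + c * \<beta>) + (b + d * \<beta>) * \<alpha>))"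
    by (intro almost_integral_mult csubring_\<alpha> ai almost_integral_mem quad_gen csubring_\<beta>)
  also have "\<alpha> * ((a + c * \<beta>) + (b + d * \<beta>) * \<alpha>) = (d * \<beta>\<^sup>2 + b * \<beta>) + (a + c * \<beta>) * \<alpha>"
    by (simp add: algebra_simps power2_eq_square)
  finally have "almost_integral (quad \<int> \<beta>) (2 * (d * \<beta>\<^sup>2 + b * \<beta>))"
    using q by (intro tn(1)) (auto simp: root intro!: quadI)
  hence "almost_integral (quad \<int> \<beta>) (2 * d * of_int m + (2 * b) * \<beta>)"
    by (simp add: root algebra_simps)
  hence b2: "2 * b \<in> \<int>"
    using q almost_integral_\<beta>[of "2 * d * of_int m" "2 * b"] by simp
  have "almost_integral (quad \<int> \<beta>) (2 * (a + c * \<beta>))"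
    using q by (intro tn1(1) quadI) auto
  hence "almost_integral (quad \<int> \<beta>) (2 * a + (2 * c) * \<beta>)"
    by (simp add: algebra_simps)
  hence AC: "2 * a \<in> \<int> \<and> 2 * c \<in> \<int>"
    using q by (intro almost_integral_\<beta>) auto
  have "almost_integral (quad \<int> \<beta>) ((a + c * \<beta>)\<^sup>2 - (b + d * \<beta>)\<^sup>2 * \<alpha>\<^sup>2)"
    using q by (intro tn1(2) quadI) auto
  also have "(a + c * \<beta>)\<^sup>2 - (b + d * \<beta>)\<^sup>2 * \<alpha>\<^sup>2 =
      (a\<^sup>2 + c\<^sup>2 * \<beta>\<^sup>2 - 2 * (b * d) * \<beta>\<^sup>2) + (2 * (a * c) - b\<^sup>2 - d\<^sup>2 * \<beta>\<^sup>2) * \<beta>"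
    by (simp add: algebra_simps power2_eq_square)
  finally have N: "a\<^sup>2 + c\<^sup>2 * of_int m - 2 * (b * d) * of_int m \<in> \<int> \<and> 2 * (a * c) - b\<^sup>2 - d\<^sup>2 * of_int m \<in> \<int>"
    using q by (intro almost_integral_\<beta>) (auto simp: root)
  obtain A B C M N where ints: "2 * a = of_int A" "2 * b = of_int B" "2 * c = of_int C"
    "a\<^sup>2 + c\<^sup>2 * of_int m - 2 * (b * d) * of_int m = of_int M"
    "2 * (a * c) - b\<^sup>2 - d\<^sup>2 * of_int m = of_int N"
    using b2 AC N by (metis Ints_cases)
  \<comment> \<open>The traces yield only \<open>2 * d * m\<close>, not \<open>2 * d\<close>. Four
    times the \<beta>-coordinate of the norm isolates \<open>m * (2 * d)^2\<close>, to which
    squarefreeness applies.\<close>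
  have "of_int m * (2 * d)\<^sup>2 = 2 * ((2 * a) * (2 * c)) - (2 * b)\<^sup>2
      - 4 * (2 * (a * c) - b\<^sup>2 - d\<^sup>2 * of_int m)"
    by (simp add: power_mult_distrib algebra_simps)
  also have "\<dots> = of_int (2 * (A * C) - B\<^sup>2 - 4 * N)"
    by (simp only: ints) simp
  finally have e: "of_int m * (2 * d)\<^sup>2 = of_int (2 * (A * C) - B\<^sup>2 - 4 * N)" .
  have "2 * d \<in> \<int>"
    by (rule squarefree_mult_square_Ints[OF m_squarefree _ e]) (use q in auto)
  then obtain D where D: "2 * d = of_int D" by (auto elim: Ints_cases)
  have "(of_int (m * D\<^sup>2) :: complex) = of_int (2 * (A * C) - B\<^sup>2 - 4 * N)"
    using e by (simp add: D)
  hence n1: "m * D\<^sup>2 = 2 * (A * C) - B\<^sup>2 - 4 * N" by (simp only: of_int_eq_iff)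
  \<comment> \<open>Four times the rational coordinate of the norm supplies the other congruence for
    the parities.\<close>
  have "of_int (4 * M) = (2 * a)\<^sup>2 + of_int m * (2 * c)\<^sup>2 - of_int m * (2 * ((2 * b) * (2 * d)))"
    by (simp add: power_mult_distrib algebra_simps flip: ints(4))
  also have "\<dots> = of_int (A\<^sup>2 + m * C\<^sup>2 - m * (2 * (B * D)))"
    by (simp only: ints D) simp
  finally have n2: "4 * M = A\<^sup>2 + m * C\<^sup>2 - m * (2 * (B * D))" by (simp only: of_int_eq_iff)
  have "even A \<and> even B \<and> even C \<and> even D"
    by (intro mod_4_quartic_norm[OF m_mod_4]) (simp_all add: n1 flip: n2)
  thus ?thesis using ints D Ints_halfI by blast
qed

text \<open>Translates between the tower, which groups even and odd powers of \<alpha> apart, and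
  coordinates in the powers of \<alpha>.\<close>

lemma quartic_coordinates:
  "x \<in> quad (quad R \<beta>) \<alpha> \<longleftrightarrow>
    (\<exists>a\<in>R. \<exists>b\<in>R. \<exists>c\<in>R. \<exists>d\<in>R. x = a + b * \<alpha> + c * \<alpha>\<^sup>2 + d * \<alpha> ^ 3)"
proof -
  have "(a + c * \<beta>) + (b + d * \<beta>) * \<alpha> = a + b * \<alpha> + c * \<alpha>\<^sup>2 + d * \<alpha> ^ 3" for a b c d
    by (simp add: algebra_simps power2_eq_square power3_eq_cube)
  thus ?thesis unfolding quad_def by (auto; metis)
qed

lemma quartic_unique:
  assumes "a \<in> \<rat>" "b \<in> \<rat>" "c \<in> \<rat>" "d \<in> \<rat>" "a' \<in> \<rat>" "b' \<in> \<rat>" "c' \<in> \<rat>" "d' \<in> \<rat>"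
    and eq: "a + b * \<alpha> + c * \<alpha>\<^sup>2 + d * \<alpha> ^ 3 = a' + b' * \<alpha> + c' * \<alpha>\<^sup>2 + d' * \<alpha> ^ 3"
  shows "a = a' \<and> b = b' \<and> c = c' \<and> d = d'"
proof -
  have "(a + c * \<beta>) + (b + d * \<beta>) * \<alpha> = (a' + c' * \<beta>) + (b' + d' * \<beta>) * \<alpha>"
    using eq by (simp add: algebra_simps power2_eq_square power3_eq_cube)
  hence "a + c * \<beta> = a' + c' * \<beta> \<and> b + d * \<beta> = b' + d' * \<beta>"
    using assms by (intro quad_unique[OF csubfield_\<beta> \<alpha>_notin] quadI) auto
  thus ?thesis
    using quad_unique[OF csubfield_Rats \<beta>_notin_Rats] assms by blast
qed

text \<open>Denominators are cleared first over \<open>\<rat>\<close>, then in both steps of the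
  tower. So algebraic integers of K are almost integral, and their coordinates are integers.\<close>

lemma algebraic_int_mem:
  assumes x: "x \<in> quad (quad \<rat> \<beta>) \<alpha>" and int: "algebraic_int x"
  shows "x \<in> quad (quad \<int> \<beta>) \<alpha>"
proof -
  have "\<exists>d::int. d \<noteq> 0 \<and> of_int d * y \<in> \<int>" if "y \<in> (\<rat> :: complex set)" for y
  proof -
    obtain a b :: int where "b > 0" "y * of_int b = of_int a"
      using \<open>y \<in> \<rat>\<close> by (rule Rats_coprimeE)
    thus ?thesis by (intro exI[of _ b]) (auto simp: mult.commute)
  qed
  hence "\<exists>d::int. d \<noteq> 0 \<and> of_int d * x \<in> quad (quad \<int> \<beta>) \<alpha>"
    using x by (intro quad_common_denominator[of _ "quad \<rat> \<beta>"] quad_common_denominator[of _ \<rat>]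
      csubring_Ints csubring_\<beta>) auto
  hence ai: "almost_integral (quad (quad \<int> \<beta>) \<alpha>) x"
    using algebraic_int_almost_integral[OF csubring_\<alpha> int] by blast
  obtain a b c d where q: "a \<in> \<rat>" "b \<in> \<rat>" "c \<in> \<rat>" "d \<in> \<rat>"
      and eq: "x = (a + c * \<beta>) + (b + d * \<beta>) * \<alpha>"
    using x by (auto simp: quad_def)
  show ?thesis
    using almost_integral_\<alpha>[OF q] ai unfolding eq by (intro quadI) auto
qed

section \<open>The field K and its degree\<close>

text \<open>The right side is a field containing \<alpha> and the rationals; conversely, its
  elements are built from these by sums and products.\<close>

lemma rat_adjoin_eq: "rat_adjoin \<alpha> = quad (quad \<rat> \<beta>) \<alpha>"
proof -
  define R where "R = (ring_of_type_algebra :: complex ring)"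
  interpret R: field R unfolding R_def by (rule field_from_type_algebra)
  have R_simps [simp]: "carrier R = UNIV" "\<one>\<^bsub>R\<^esub> = 1" "\<zero>\<^bsub>R\<^esub> = 0" "x \<oplus>\<^bsub>R\<^esub> y = x + y" "x \<otimes>\<^bsub>R\<^esub> y = x * y" for x y
    by (auto simp: R_def ring_of_type_algebra_def)
  have minus: "\<ominus>\<^bsub>R\<^esub> x = - x" for x
    using R.minus_equality[of "- x" x] by simp
  \<comment> \<open>The ring structure leaves the inverse of 0 unspecified, so the two inverses are
    compared at nonzero elements.\<close>
  have inv: "inv\<^bsub>R\<^esub> x = inverse x" if "x \<noteq> 0" for x
    using R.inv_unique'[of x "inverse x"] that by (simp add: R.comm_inv_char)
  let ?E = "quad (quad \<rat> \<beta>) \<alpha>"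
  let ?G = "generate_field R (insert \<alpha> \<rat>)"
  note E = csubfield_csubring[OF csubfield_\<alpha>]
  have "x \<in> ?E" if "x \<in> ?G" for x
    using that
  proof induction
    case (incl h)
    have "\<alpha> \<in> ?E"
      by (intro quad_gen csubfield_csubring csubfield_\<beta>)
    moreover have "q \<in> ?E" if "q \<in> \<rat>" for q
      by (intro quad_base csubfield_csubring csubfield_\<beta> csubfield_Rats that)
    ultimately show ?case using incl by auto
  qed (auto simp: minus inv intro: csubring_intros E csubfield_inverse[OF csubfield_\<alpha>])
  moreover have "x \<in> ?G" if "x \<in> ?E" for x
  proof -
    have add: "a + b \<in> ?G" and mult: "a * b \<in> ?G" if "a \<in> ?G" "b \<in> ?G" for a b
      using generate_field.eng_add[OF that] generate_field.eng_mult[OF that] by simp_all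
    have \<alpha>: "\<alpha> \<in> ?G" and rat: "\<And>q. q \<in> \<rat> \<Longrightarrow> q \<in> ?G"
      by (auto intro: generate_field.incl)
    show ?thesis
      using that by (auto simp: quad_def power2_eq_square intro!: add mult \<alpha>) (auto intro: rat)
  qed
  ultimately show ?thesis
    unfolding rat_adjoin_def R_def by blast
qed

lemma sum_lessThan_4: "(\<Sum>i<4. f i) = f 0 + f 1 + f 2 + f (3::nat)"
  for f :: "nat \<Rightarrow> complex"
  by (simp add: eval_nat_numeral)

lemma field_degree_rat_adjoin: "field_degree (rat_adjoin \<alpha>) = 4"
proof -
  interpret vector_space "\<lambda>(q::rat) (x::complex). of_rat q * x"
    by (rule vector_space_of_rat)
  let ?B = "(\<lambda>i. \<alpha> ^ i) ` {..<4::nat}"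
  have zero: "a = 0 \<and> b = 0 \<and> c = 0 \<and> d = 0"
    if "of_rat a + of_rat b * \<alpha> + of_rat c * \<alpha>\<^sup>2 + of_rat d * \<alpha> ^ 3 = 0" for a b c d :: rat
    using quartic_unique[of "of_rat a" "of_rat b" "of_rat c" "of_rat d" 0 0 0 0] that by simp
  \<comment> \<open>The basis is a set, so the four powers must be distinct for its cardinality and
    for reindexing sums over it.\<close>
  have inj: "inj_on (\<lambda>i. \<alpha> ^ i) {..<4::nat}"
  proof (rule inj_onI)
    fix i j :: nat assume ij: "i \<in> {..<4}" "j \<in> {..<4}" "\<alpha> ^ i = \<alpha> ^ j"
    \<comment> \<open>The relation with 1 at \<open>i\<close> and -1 at \<open>j\<close>;
      independence makes it vanish, which forces \<open>i = j\<close>.\<close>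
    define e where "e k = (if k = i then 1 else 0) - (if k = j then 1 else 0 :: rat)" for k
    have "(\<Sum>k<4. of_rat (e k) * \<alpha> ^ k) =
        (\<Sum>k<4. (if k = i then \<alpha> ^ k else 0) - (if k = j then \<alpha> ^ k else 0))"
      by (intro sum.cong) (auto simp: e_def of_rat_diff)
    also have "\<dots> = 0"
      using ij by (simp add: sum_subtractf)
    finally have "(\<Sum>k<4. of_rat (e k) * \<alpha> ^ k) = 0" .
    hence "e 0 = 0 \<and> e 1 = 0 \<and> e 2 = 0 \<and> e 3 = 0"
      by (intro zero) (simp add: sum_lessThan_4)
    moreover have "i = 0 \<or> i = 1 \<or> i = 2 \<or> i = 3"
      using ij by auto
    ultimately show "i = j"
      by (auto simp: e_def split: if_splits)
  qed
  have "dim (rat_adjoin \<alpha>) = 4"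
  proof (rule dim_unique)
    show "?B \<subseteq> rat_adjoin \<alpha>"
      unfolding rat_adjoin_eq
      by (auto intro!: csubring_power quad_gen csubfield_csubring csubfield_\<alpha> csubfield_\<beta>)
    show "rat_adjoin \<alpha> \<subseteq> span ?B"
    proof
      fix x assume "x \<in> rat_adjoin \<alpha>"
      then obtain a b c d :: rat
        where "x = of_rat a + of_rat b * \<alpha> + of_rat c * \<alpha>\<^sup>2 + of_rat d * \<alpha> ^ 3"
        unfolding rat_adjoin_eq quartic_coordinates by (auto elim!: Rats_cases)
      hence "x = of_rat a * \<alpha> ^ 0 + of_rat b * \<alpha> ^ 1 + of_rat c * \<alpha> ^ 2 + of_rat d * \<alpha> ^ 3"
        by simp
      also have "\<dots> \<in> span ?B"
        by (intro span_add span_scale span_base imageI) auto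
      finally show "x \<in> span ?B" .
    qed
    show "independent ?B"
    proof (rule independent_if_scalars_zero)
      fix f x assume sum: "(\<Sum>x\<in>?B. of_rat (f x) * x) = 0" and x: "x \<in> ?B"
      have "(\<Sum>i<4. of_rat (f (\<alpha> ^ i)) * \<alpha> ^ i) = 0"
        using sum by (simp add: sum.reindex[OF inj])
      hence "f (\<alpha> ^ 0) = 0 \<and> f (\<alpha> ^ 1) = 0 \<and> f (\<alpha> ^ 2) = 0 \<and> f (\<alpha> ^ 3) = 0"
        by (intro zero) (simp add: sum_lessThan_4)
      moreover obtain i where i: "x = \<alpha> ^ i" "i < 4"
        using x by auto
      hence "i = 0 \<or> i = 1 \<or> i = 2 \<or> i = 3" by auto
      ultimately show "f x = 0"
        using i by auto
    qed simp
    show "card ?B = 4"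
      by (simp add: card_image[OF inj])
  qed
  thus ?thesis by (simp add: field_degree_def)
qed

section \<open>Generators of power integral bases\<close>

text \<open>The monic polynomial X^4 sends \<alpha>^i to m^i, which is an algebraic integer.\<close>

lemma power_\<alpha>_mem: "\<alpha> ^ i \<in> ring_of_integers (rat_adjoin \<alpha>)"
proof -
  have "algebraic_int ((of_int m :: complex) ^ i)"
    by (intro int_imp_algebraic_int) simp
  moreover have "poly (monom 1 4) (\<alpha> ^ i) = of_int m ^ i"
    using power_mult[of \<alpha> i 4] power_mult[of \<alpha> 4 i] by (simp add: poly_monom root mult.commute)
  ultimately have "algebraic_int (\<alpha> ^ i)"
    by (rule algebraic_int_root[of "of_int m ^ i" "monom 1 4"])
       (auto simp: degree_monom_eq)
  thus ?thesis
    unfolding ring_of_integers_def rat_adjoin_eq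
    by (auto intro!: csubring_power quad_gen csubfield_csubring csubfield_\<alpha> csubfield_\<beta>)
qed

text \<open>Coordinates exist by \<open>algebraic_int_mem\<close> and are unique by
  \<open>quartic_unique\<close>.\<close>

lemma generates_\<alpha>: "generates_power_integral_basis (rat_adjoin \<alpha>) \<alpha>"
  unfolding generates_power_integral_basis_def integral_basis_def field_degree_rat_adjoin
proof (intro conjI allI impI ballI power_\<alpha>_mem)
  show "\<alpha> \<in> ring_of_integers (rat_adjoin \<alpha>)"
    using power_\<alpha>_mem[of 1] by simp
  fix x assume "x \<in> ring_of_integers (rat_adjoin \<alpha>)"
  hence "x \<in> quad (quad \<int> \<beta>) \<alpha>"
    using algebraic_int_mem by (simp add: ring_of_integers_def rat_adjoin_eq)
  then obtain a b c d :: int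
    where x: "x = of_int a + of_int b * \<alpha> + of_int c * \<alpha>\<^sup>2 + of_int d * \<alpha> ^ 3"
    unfolding quartic_coordinates by (auto elim!: Ints_cases)
  show "\<exists>!c::nat \<Rightarrow> int. c \<in> extensional {..<4} \<and> x = (\<Sum>i<4. of_int (c i) * \<alpha> ^ i)"
  proof (rule ex1I)
    \<comment> \<open>The restricted abstraction is \<open>undefined\<close> outside
      \<open>{..<4}\<close>, as \<open>extensional\<close> demands.\<close>
    let ?c = "\<lambda>i\<in>{..<4::nat}. if i = 0 then a else if i = 1 then b else if i = 2 then c else d"
    show "?c \<in> extensional {..<4} \<and> x = (\<Sum>i<4. of_int (?c i) * \<alpha> ^ i)"
      by (simp add: sum_lessThan_4 x)
    fix e :: "nat \<Rightarrow> int"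
    assume e: "e \<in> extensional {..<4} \<and> x = (\<Sum>i<4. of_int (e i) * \<alpha> ^ i)"
    have "of_int (e 0) = (of_int a :: complex) \<and> of_int (e 1) = (of_int b :: complex) \<and>
        of_int (e 2) = (of_int c :: complex) \<and> of_int (e 3) = (of_int d :: complex)"
      using e x by (intro quartic_unique) (auto simp: sum_lessThan_4)
    hence e': "e 0 = a \<and> e 1 = b \<and> e 2 = c \<and> e 3 = d" by simp
    show "e = ?c"
    proof (rule extensionalityI)
      fix i :: nat assume "i \<in> {..<4}"
      hence "i = 0 \<or> i = 1 \<or> i = 2 \<or> i = 3" by auto
      thus "e i = ?c i" using e' by auto
    qed (use e in auto)
  qed
qed

text \<open>Equivalence ignores integer translations, so only the part \<open>w\<close> of
  \<open>\<gamma>\<close> without constant term matters. Expanding \<alpha> in powers of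
  \<open>w\<close> and comparing coordinates gives the hypotheses of
  \<open>unit_equations_solution\<close>.\<close>

lemma generator_equivalent:
  assumes "generates_power_integral_basis (rat_adjoin \<alpha>) \<gamma>"
  shows "pib_equivalent \<gamma> \<alpha>"
proof -
  have "\<gamma> \<in> quad (quad \<int> \<beta>) \<alpha>"
    using assms algebraic_int_mem
    by (simp add: generates_power_integral_basis_def ring_of_integers_def rat_adjoin_eq)
  then obtain a x y z :: int
    where \<gamma>: "\<gamma> = of_int a + of_int x * \<alpha> + of_int y * \<alpha>\<^sup>2 + of_int z * \<alpha> ^ 3"
    unfolding quartic_coordinates by (auto elim!: Ints_cases)
  define w where "w = of_int x * \<alpha> + of_int y * \<alpha>\<^sup>2 + of_int z * \<alpha> ^ 3"
  obtain c :: "nat \<Rightarrow> int" where "\<alpha> = (\<Sum>i<4. of_int (c i) * \<gamma> ^ i)"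
    using assms power_\<alpha>_mem[of 1]
    unfolding generates_power_integral_basis_def integral_basis_def field_degree_rat_adjoin
    by fastforce
  hence \<alpha>: "\<alpha> = of_int (c 0) + of_int (c 1) * \<gamma> + of_int (c 2) * \<gamma>\<^sup>2 + of_int (c 3) * \<gamma> ^ 3"
    by (simp add: sum_lessThan_4)
  \<comment> \<open>The Taylor coefficients at \<open>a\<close> of the cubic with coefficients
    \<open>c 0\<close> to \<open>c 3\<close>.\<close>
  define p\<^sub>0 p q r where
    p0_def: "p\<^sub>0 = c 0 + c 1 * a + c 2 * a\<^sup>2 + c 3 * a ^ 3" and
    p_def: "p = c 1 + 2 * a * c 2 + 3 * a\<^sup>2 * c 3" and q_def: "q = c 2 + 3 * a * c 3" and r_def: "r = c 3"
  have \<gamma>w: "\<gamma> = of_int a + w"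
    by (simp add: \<gamma> w_def)
  have \<alpha>w: "\<alpha> = of_int p\<^sub>0 + of_int p * w + of_int q * w\<^sup>2 + of_int r * w ^ 3"
    unfolding \<gamma>w p0_def p_def q_def r_def
    by (subst \<alpha>, unfold \<gamma>w) (simp add: algebra_simps power2_eq_square power3_eq_cube)
  \<comment> \<open>Reading \<open>m\<close> as \<alpha>^4 turns this and the formula for
    \<open>w ^ 3\<close> into polynomial identities in \<alpha>.\<close>
  have w2: "w\<^sup>2 = of_int (y\<^sup>2 * m + 2 * x * z * m) + of_int (2 * y * z * m) * \<alpha> +
      of_int (x\<^sup>2 + z\<^sup>2 * m) * \<alpha>\<^sup>2 + of_int (2 * x * y) * \<alpha> ^ 3"
    unfolding w_def of_int_add of_int_mult of_int_power of_int_numeral root[symmetric]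
    by (simp add: algebra_simps power2_eq_square power3_eq_cube power4_eq_xxxx)
  have w3: "w ^ 3 = of_int (3 * y * m * (x\<^sup>2 + z\<^sup>2 * m)) +
      of_int (x * (3 * y\<^sup>2 * m + 2 * x * z * m) + z * m * (x\<^sup>2 + z\<^sup>2 * m)) * \<alpha> +
      of_int (y * (y\<^sup>2 * m + 6 * x * z * m)) * \<alpha>\<^sup>2 +
      of_int (x * (x\<^sup>2 + z\<^sup>2 * m) + z * (3 * y\<^sup>2 * m + 2 * x * z * m)) * \<alpha> ^ 3"
    unfolding w_def of_int_add of_int_mult of_int_power of_int_numeral root[symmetric]
    by (simp add: algebra_simps power2_eq_square power3_eq_cube power4_eq_xxxx)
  \<comment> \<open>The coordinates of the expansion in \<open>w\<close> with respect to the powers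
    of \<alpha>, to be compared with 0, 1, 0, 0.\<close>
  let ?e0 = "p\<^sub>0 + q * (y\<^sup>2 * m + 2 * x * z * m) + r * (3 * y * m * (x\<^sup>2 + z\<^sup>2 * m))"
  let ?e1 = "p * x + q * (2 * y * z * m) +
      r * (x * (3 * y\<^sup>2 * m + 2 * x * z * m) + z * m * (x\<^sup>2 + z\<^sup>2 * m))"
  let ?e2 = "p * y + q * (x\<^sup>2 + z\<^sup>2 * m) + r * (y * (y\<^sup>2 * m + 6 * x * z * m))"
  let ?e3 = "p * z + q * (2 * x * y) +
      r * (x * (x\<^sup>2 + z\<^sup>2 * m) + z * (3 * y\<^sup>2 * m + 2 * x * z * m))"
  have "of_int ?e0 + of_int ?e1 * \<alpha> + of_int ?e2 * \<alpha>\<^sup>2 + of_int ?e3 * \<alpha> ^ 3 =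
      of_int p\<^sub>0 + of_int p * w + of_int q * w\<^sup>2 + of_int r * w ^ 3"
    unfolding w2 w3 unfolding w_def of_int_add of_int_mult of_int_power of_int_numeral
    by (simp only: ring_distribs mult_ac add_ac)
  also have "\<dots> = 0 + 1 * \<alpha> + 0 * \<alpha>\<^sup>2 + 0 * \<alpha> ^ 3"
    by (simp flip: \<alpha>w)
  finally have "of_int ?e0 = (0 :: complex) \<and> of_int ?e1 = (1 :: complex) \<and>
      of_int ?e2 = (0 :: complex) \<and> of_int ?e3 = (0 :: complex)"
    by (intro quartic_unique) (simp_all only: Rats_of_int Rats_0 Rats_1)
  hence "?e1 = 1 \<and> ?e2 = 0 \<and> ?e3 = 0"
    by (simp only: of_int_eq_iff of_int_eq_1_iff of_int_eq_0_iff)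
  hence "(x = 1 \<or> x = -1) \<and> y = 0 \<and> z = 0"
    by (intro unit_equations_solution[OF m_less]) auto
  \<comment> \<open>Now \<open>w\<close> is \<alpha> or its negative, so the difference or the sum
    of \<open>\<gamma>\<close> and \<alpha> is the integer \<open>a\<close>.\<close>
  thus ?thesis
    by (auto simp: pib_equivalent_def \<gamma>)
qed

end

theorem theorem1:
  fixes m :: int and \<alpha> :: complex and K :: "complex set"
  assumes "m < -1"
    and "squarefree m"
    and "m mod 4 = 2 \<or> m mod 4 = 3"
    and "\<alpha> ^ 4 = of_int m"
    and "K = rat_adjoin \<alpha>"
  shows "generates_power_integral_basis K \<alpha> \<and>
    (\<forall>\<gamma>. generates_power_integral_basis K \<gamma> \<longrightarrow> pib_equivalent \<gamma> \<alpha>)"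
proof -
  interpret pure_quartic m \<alpha>
    by unfold_locales (use assms in auto)
  show ?thesis
    using generates_\<alpha> generator_equivalent assms(5) by blast
qed

end
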